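(* For every integer $q\ge2$ there exists a constant $c_1(q)$, depending only on $q$, with $c_1(q)=O(\sqrt q)$, such that for every $d,N\in\mathbb N$ and every $$P=\sum_{\substack{\alpha\in\{0,\ldots,q-1\}^N\\ |\operatorname{supp}(\alpha)|\le d}}a_\alpha z^\alpha\in\mathcal B_{\le d,q}(\mathbb T^N)$$ one has $$\Bigg(\sum_{\substack{\alpha\in\{0,\ldots,q-1\}^N\\ |\operatorname{supp}(\alpha)|\le d}}|a_\alpha|^{\frac{2d}{d+1}}\Bigg)^{\frac{d+1}{2d}}\le c_1(q)^d\,\|P\|_{L_\infty(\mathbb T^N)}.$$
   Context: $\mathbb N=\{1,2,\ldots\}$, $\mathbb T=\{z\in\mathbb C:|z|=1\}$. For $\alpha\in\{0,\ldots,q-1\}^N$, $z^\alpha=z_1^{\alpha_1}\cdots z_N^{\alpha_N}$ and $\operatorname{supp}(\alpha)=\{j:\alpha_j\neq0\}$. $\mathcal B_{\le d,q}(\mathbb T^N)=\operatorname{span}_{\mathbb C}\{z^\alpha:\alpha\in\{0,\ldots,q-1\}^N,\ |\operatorname{supp}(\alpha)|\le d\}$. $\|P\|_{L_\infty(\mathbb T^N)}=\sup_{z\in\mathbb T^N}|P(z)|$. $c_1(q)=O(\sqrt q)$ means $c_1(q)\le A\sqrt q$ for all $q\ge 2$ with an absolute constant $A$. *)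

theory Defs
  imports "HOL-Analysis.Analysis" "HOL-Library.Function_Algebras"
begin

text \<open>
  The dimension \<open>N\<close> is quantified inside the statement, so points of \<open>\<complex>\<^sup>N\<close> and multi-indices
  are functions on \<^typ>\<open>nat\<close> whose relevant coordinates are those in \<open>{1..N}\<close>.
\<close>

definition torus :: "nat \<Rightarrow> (nat \<Rightarrow> complex) set"
  where "torus N = {1..N} \<rightarrow>\<^sub>E sphere 0 1"

definition supp :: "nat \<Rightarrow> (nat \<Rightarrow> nat) \<Rightarrow> nat set"
  where "supp N \<alpha> = {j \<in> {1..N}. \<alpha> j \<noteq> 0}"

definition multi_indices :: "nat \<Rightarrow> nat \<Rightarrow> nat \<Rightarrow> (nat \<Rightarrow> nat) set"
  where "multi_indices d q N = {\<alpha> \<in> {1..N} \<rightarrow>\<^sub>E {..<q}. card (supp N \<alpha>) \<le> d}"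

definition monomial :: "nat \<Rightarrow> (nat \<Rightarrow> nat) \<Rightarrow> (nat \<Rightarrow> complex) \<Rightarrow> complex"
  where "monomial N \<alpha> z = (\<Prod>j\<in>{1..N}. z j ^ \<alpha> j)"

text \<open>
  The complex span of the monomials, for the pointwise vector space structure on functions.
  Its elements are polynomial functions of \<open>z\<^sub>1, \<dots>, z\<^sub>N\<close> on all of \<open>\<complex>\<^sup>N\<close>;
  they are determined by their restriction to the torus.
\<close>

definition poly_space :: "nat \<Rightarrow> nat \<Rightarrow> nat \<Rightarrow> ((nat \<Rightarrow> complex) \<Rightarrow> complex) set"
  where "poly_space d q N =
    module.span (\<lambda>(c::complex) f z. c * f z) (monomial N ` multi_indices d q N)"

definition torus_norm :: "nat \<Rightarrow> ((nat \<Rightarrow> complex) \<Rightarrow> complex) \<Rightarrow> real"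
  where "torus_norm N P = (SUP z\<in>torus N. cmod (P z))"

lemma finite_multi_indices: "finite (multi_indices d q N)"
  unfolding multi_indices_def by (rule finite_subset[of _ "{1..N} \<rightarrow>\<^sub>E {..<q}"]) (auto intro: finite_PiE)

lemma module_complex_fun:
  "module (\<lambda>(c::complex) (f :: 'a \<Rightarrow> complex) z. c * f z)"
  by unfold_locales (auto simp: fun_eq_iff algebra_simps)

lemma sum_in_poly_space:
  "(\<lambda>z. \<Sum>\<alpha>\<in>multi_indices d q N. a \<alpha> * monomial N \<alpha> z) \<in> poly_space d q N"
proof -
  interpret module "\<lambda>(c::complex) (f :: (nat \<Rightarrow> complex) \<Rightarrow> complex) z. c * f z"
    by (rule module_complex_fun)
  have "(\<lambda>z. \<Sum>\<alpha>\<in>I. a \<alpha> * monomial N \<alpha> z) = (\<Sum>\<alpha>\<in>I. (\<lambda>z. a \<alpha> * monomial N \<alpha> z))"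
    if "finite I" for I
    using that by (induction I rule: finite_induct) (auto simp: fun_eq_iff)
  then show ?thesis
    unfolding poly_space_def
    by (simp add: finite_multi_indices span_sum span_scale span_base)
qed

lemma norm_monomial_torus:
  assumes "z \<in> torus N"
  shows "cmod (monomial N \<alpha> z) = 1"
  using assms by (auto simp: torus_def monomial_def norm_power PiE_iff
      simp flip: prod_norm intro!: prod.neutral)

lemma bdd_above_torus:
  "bdd_above ((\<lambda>z. cmod (\<Sum>\<alpha>\<in>I. a \<alpha> * monomial N \<alpha> z)) ` torus N)"
proof (rule bdd_aboveI2)
  fix z assume "z \<in> torus N"
  then show "cmod (\<Sum>\<alpha>\<in>I. a \<alpha> * monomial N \<alpha> z) \<le> (\<Sum>\<alpha>\<in>I. cmod (a \<alpha>))"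
    by (intro sum_norm_le) (simp add: norm_mult norm_monomial_torus)
qed

end

theory Submission
  imports Defs "HOL-Computational_Algebra.Polynomial"
begin

text \<open>
  Restrict to the \<open>q\<close>-th roots of unity, where all averages are finite sums and the monomials are
  orthogonal. For a letter \<open>(j, t)\<close> with \<open>t \<noteq> 0\<close> let \<open>f\<^bsub>j,t\<^esub>\<close> be the \<open>\<ell>\<^sub>2\<close>-norm of the coefficients
  with \<open>\<alpha>\<^sub>j = t\<close>. A Blei-type inequality, obtained by a single weighted AM-GM, bounds the
  \<open>\<ell>\<close>-norm with exponent \<open>2d/(d+1)\<close> by \<open>3B\<close> whenever \<open>B\<close> dominates both the total
  \<open>\<ell>\<^sub>2\<close>-norm and \<open>\<Sum> f\<^bsub>j,t\<^esub>\<close>.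

  A Bonami-type fourth moment estimate, in which each coordinate costs a factor \<open>4 \<surd>q\<close>, compares
  \<open>f\<^bsub>j,t\<^esub>\<close> with the \<open>L\<^sub>1\<close>-norm of the slice \<open>P\<^bsub>j,t\<^esub>\<close> over the remaining coordinates; slices have
  support size at most \<open>d - 1\<close>, which leaves one factor \<open>\<surd>q\<close> to pass from \<open>\<Sum>\<^sub>t |P\<^bsub>j,t\<^esub>|\<close> to
  a single increment of \<open>P\<close> in the coordinate \<open>j\<close>. To bound the sum of the increments, replace each
  coordinate \<open>x\<^sub>j\<close> by \<open>y\<^sub>j\<close> independently with probability \<open>s\<close>: the expectation of \<open>P\<close> is a
  polynomial in \<open>s\<close> of degree at most \<open>d\<close>, bounded on \<open>[0,1]\<close> by the norm of \<open>P\<close>, and the sum of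
  the increments is its derivative at \<open>0\<close>.
\<close>

section \<open>Splitting off one coordinate, and a Markov-type bound at an endpoint\<close>

lemma sum_PiE_insert:
  assumes "j \<notin> J"
  shows "(\<Sum>\<alpha>\<in>insert j J \<rightarrow>\<^sub>E A. g \<alpha>) = (\<Sum>t\<in>A. \<Sum>\<beta>\<in>J \<rightarrow>\<^sub>E A. g (\<beta>(j := t)))"
proof -
  have "(\<Sum>\<alpha>\<in>insert j J \<rightarrow>\<^sub>E A. g \<alpha>) = (\<Sum>(t, \<beta>)\<in>A \<times> (J \<rightarrow>\<^sub>E A). g (\<beta>(j := t)))"
    unfolding PiE_insert_eq
    by (subst sum.reindex[OF inj_combinator[OF assms]]) (simp add: case_prod_unfold)
  then show ?thesis by (simp add: sum.cartesian_product)
qed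

text \<open>Markov's inequality at the endpoint 0 with a crude constant: a loss exponential in d is
  harmless, because the final constant is raised to the power d. This permits an induction on the
  degree that pays a factor 5 per degree.\<close>

lemma coeff_1_bound:
  fixes p :: "complex poly"
  assumes "degree p \<le> d" and "\<And>t. 0 \<le> t \<Longrightarrow> t \<le> 1 \<Longrightarrow> cmod (poly p (of_real t)) \<le> M"
  shows "cmod (coeff p 1) \<le> 2 * 5 ^ d * M"
  using assms
proof (induction d arbitrary: p M)
  case 0
  have "0 \<le> M" using 0(2)[of 0] norm_ge_zero order_trans by (metis order_refl zero_le_one)
  moreover have "coeff p 1 = 0" using 0 by (intro coeff_eq_0) simp
  ultimately show ?case by simp
next
  case (Suc n)
  have M: "0 \<le> M" using Suc(3)[of 0] norm_ge_zero order_trans by (metis order_refl zero_le_one)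
  show ?case
  \<comment> \<open>The combination used below multiplies the linear coefficient by 2^n - 1, which
    vanishes for n = 0; degree one is settled by two point evaluations.\<close>
  proof (cases "n = 0")
    case True
    have "coeff p 1 = poly p (of_real 1) - poly p (of_real 0)"
      using Suc(2) True by (simp add: poly_altdef poly_0_coeff_0 atMost_Suc)
        (cases "degree p = 0"; auto simp: coeff_eq_0 le_Suc_eq)
    then have "cmod (coeff p 1) \<le> M + M"
      by (metis norm_triangle_le_diff Suc(3) add_mono order_refl zero_le_one)
    with M True show ?thesis by simp
  next
    case False
    \<comment> \<open>\<open>2\<^bsup>n+1\<^esup> p(t/2) - p(t)\<close> has no term of degree \<open>n+1\<close>.\<close>
    define r where "r = smult (2 ^ Suc n) (pcompose p [:0, 1/2:]) - p"
    have c: "coeff r i = (2 ^ Suc n * (1/2) ^ i - 1) * coeff p i" for i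
      by (simp add: r_def coeff_pcompose_linear algebra_simps)
    have "degree r \<le> n"
    proof (rule degree_le, safe)
      fix i assume "n < i"
      show "coeff r i = 0"
      proof (cases "i = Suc n")
        case True then show ?thesis by (simp add: c power_one_over)
      next
        case False then show ?thesis using \<open>n < i\<close> Suc(2) by (simp add: c coeff_eq_0)
      qed
    qed
    moreover have "cmod (poly r (of_real t)) \<le> (2 ^ Suc n + 1) * M" if "0 \<le> t" "t \<le> 1" for t
    proof -
      have "poly r (of_real t) = 2 ^ Suc n * poly p (of_real (t/2)) - poly p (of_real t)"
        by (simp add: r_def poly_pcompose)
      also have "cmod \<dots> \<le> 2 ^ Suc n * M + M"
        using that Suc(3)[of "t/2"] Suc(3)[of t]
        by (intro norm_triangle_le_diff add_mono) (auto simp: norm_mult norm_power)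
      finally show ?thesis by (simp add: algebra_simps)
    qed
    ultimately have "cmod (coeff r 1) \<le> 2 * 5 ^ n * ((2 ^ Suc n + 1) * M)"
      by (rule Suc.IH)
    moreover have "cmod (coeff r 1) = (2 ^ n - 1) * cmod (coeff p 1)"
    proof -
      have "coeff r 1 = of_real (2 ^ n - 1) * coeff p 1" by (simp add: c)
      then show ?thesis by (simp only: norm_mult norm_of_real) simp
    qed
    \<comment> \<open>The factor 5: the sup bound is multiplied by 2^(n+1) + 1 and the linear
      coefficient by 2^n - 1; the ratio is largest, exactly 5, at n = 1.\<close>
    moreover have "(2 ^ Suc n + 1) * (2 * 5 ^ n * M) \<le> (5 * (2 ^ n - 1)) * (2 * 5 ^ n * M)"
    proof (rule mult_right_mono)
      have "(2::real) ^ 1 \<le> 2 ^ n" using False by (intro power_increasing) auto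
      then show "2 ^ Suc n + 1 \<le> 5 * (2 ^ n - 1 :: real)" by simp
    qed (use M in simp)
    ultimately have "(2 ^ n - 1) * cmod (coeff p 1) \<le> (2 ^ n - 1) * (2 * 5 ^ Suc n * M)"
      by (simp add: algebra_simps)
    moreover have "(0::real) < 2 ^ n - 1" using False by simp
    ultimately show ?thesis by (simp only: mult_le_cancel_left_pos)
  qed
qed

section \<open>Polynomials in one variable on the q-th roots of unity\<close>

definition zeta :: "nat \<Rightarrow> complex" where "zeta q = cis (2 * pi / real q)"

lemma norm_zeta_power [simp]: "cmod (zeta q ^ n) = 1"
  by (simp add: zeta_def norm_power)

lemma zeta_orthogonal:
  assumes "t < q" "u < q"
  shows "(\<Sum>s<q. zeta q ^ (t * s) * cnj (zeta q ^ (u * s))) = (if t = u then of_nat q else 0)"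
proof -
  define w where "w = zeta q ^ t * cnj (zeta q ^ u)"
  have sum: "(\<Sum>s<q. zeta q ^ (t * s) * cnj (zeta q ^ (u * s))) = (\<Sum>s<q. w ^ s)"
    by (simp add: w_def power_mult power_mult_distrib)
  show ?thesis
  proof (cases "t = u")
    case True
    then have "w = of_real ((cmod (zeta q ^ t))\<^sup>2)"
      by (simp only: w_def complex_norm_square)
    then have "w = 1" by simp
    with True sum show ?thesis by simp
  next
    case False
    have w: "w = cis (2 * pi * (real t - real u) / real q)"
      unfolding w_def zeta_def Complex.DeMoivre cis_cnj cis_mult
      by (intro arg_cong[where f = cis]) (simp add: algebra_simps diff_divide_distrib)
    \<comment> \<open>Equality would make q divide t - u, impossible for distinct t and u below
      q.\<close>
    have "w \<noteq> 1"
    proof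
      assume "w = 1"
      then have "cos (2 * pi * (real t - real u) / real q) = 1"
        unfolding w by (metis cis.sel(1) one_complex.sel(1))
      then obtain n :: int where "2 * pi * (real t - real u) / real q = of_int n * 2 * pi"
        using cos_one_2pi_int by blast
      then have "2 * pi * (real t - real u) = 2 * pi * (of_int n * real q)"
        using assms by (simp add: field_simps)
      then have "real t - real u = of_int n * real q" by simp
      then have n: "int t - int u = n * int q"
        by (metis (mono_tags, lifting) of_int_diff of_int_eq_iff of_int_mult of_int_of_nat_eq)
      have "\<bar>int t - int u\<bar> < int q" using assms by linarith
      with n have "\<bar>n\<bar> * int q < 1 * int q" by (simp add: abs_mult)
      then have "n = 0" by (simp only: mult_less_cancel_right) auto
      with n False show False by simp
    qed
    moreover have "w ^ q = 1"
    proof -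
      have "w ^ q = cis (2 * pi * of_int (int t - int u))"
        using assms by (simp add: w Complex.DeMoivre)
      also have "\<dots> = 1" by (rule cis_multiple_2pi) simp
      finally show ?thesis .
    qed
    ultimately show ?thesis unfolding sum using False by (simp add: geometric_sum)
  qed
qed

lemma parseval_one:
  "(\<Sum>s<q. (cmod (\<Sum>t<q. zeta q ^ (t * s) * c t))\<^sup>2) = real q * (\<Sum>t<q. (cmod (c t))\<^sup>2)"
proof -
  have "complex_of_real (\<Sum>s<q. (cmod (\<Sum>t<q. zeta q ^ (t * s) * c t))\<^sup>2)
      = (\<Sum>s<q. \<Sum>t<q. \<Sum>u<q. (zeta q ^ (t * s) * cnj (zeta q ^ (u * s))) * (c t * cnj (c u)))"
    by (simp only: of_real_sum complex_norm_square cnj_sum sum_product complex_cnj_mult)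
      (simp add: mult_ac)
  also have "\<dots> = (\<Sum>t<q. \<Sum>u<q. (\<Sum>s<q. zeta q ^ (t * s) * cnj (zeta q ^ (u * s))) * (c t * cnj (c u)))"
    by (subst sum.swap, rule sum.cong[OF refl], subst sum.swap) (simp only: sum_distrib_right)
  also have "\<dots> = (\<Sum>t<q. of_nat q * (c t * cnj (c t)))"
  proof (rule sum.cong[OF refl])
    fix t assume t: "t \<in> {..<q}"
    have "(\<Sum>u<q. (\<Sum>s<q. zeta q ^ (t * s) * cnj (zeta q ^ (u * s))) * (c t * cnj (c u)))
      = (\<Sum>u<q. if u = t then of_nat q * (c t * cnj (c t)) else 0)"
      using t by (intro sum.cong refl, subst zeta_orthogonal) auto
    also have "\<dots> = of_nat q * (c t * cnj (c t))" using t by simp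
    finally show "(\<Sum>u<q. (\<Sum>s<q. zeta q ^ (t * s) * cnj (zeta q ^ (u * s))) * (c t * cnj (c u)))
      = of_nat q * (c t * cnj (c t))" .
  qed
  also have "\<dots> = complex_of_real (real q * (\<Sum>t<q. (cmod (c t))\<^sup>2))"
    by (simp only: sum_distrib_left of_real_sum of_real_mult complex_norm_square of_real_of_nat_eq)
  finally show ?thesis by (simp only: of_real_eq_iff)
qed

text \<open>The term linear in h is kept exactly, since it averages to zero once h has mean zero;
  the others are bounded through |Re (g * cnj h)| <= |g| |h|, and 4 |g| |h|^3 is split by
  AM-GM.\<close>

lemma norm_add_power4:
  fixes g h :: complex
  shows "cmod (g + h) ^ 4 \<le> cmod g ^ 4 + 4 * (cmod g)\<^sup>2 * Re (g * cnj h)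
           + 8 * (cmod g)\<^sup>2 * (cmod h)\<^sup>2 + 3 * cmod h ^ 4"
proof -
  define G H r where "G = cmod g" and "H = cmod h" and "r = Re (g * cnj h)"
  have r: "\<bar>r\<bar> \<le> G * H"
    unfolding r_def G_def H_def by (metis abs_Re_le_cmod complex_mod_cnj norm_mult)
  have e: "(cmod (g + h))\<^sup>2 = G\<^sup>2 + 2 * r + H\<^sup>2"
    by (simp add: G_def H_def r_def cmod_power2) (simp add: power2_eq_square algebra_simps)
  have "cmod (g + h) ^ 4 = ((cmod (g + h))\<^sup>2)\<^sup>2" by simp
  also have "\<dots> = (G\<^sup>2 + 2 * r + H\<^sup>2)\<^sup>2" by (simp only: e)
  also have "\<dots> = G^4 + 4 * G\<^sup>2 * r + 2 * G\<^sup>2 * H\<^sup>2 + 4 * r\<^sup>2 + 4 * r * H\<^sup>2 + H^4"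
    by (simp add: power2_eq_square power4_eq_xxxx algebra_simps)
  also have "4 * r\<^sup>2 \<le> 4 * (G\<^sup>2 * H\<^sup>2)"
    using power_mono[OF r, of 2] by (simp add: power_mult_distrib)
  also have "4 * r * H\<^sup>2 \<le> 2 * G\<^sup>2 * H\<^sup>2 + 2 * H^4"
  proof -
    have "4 * r * H\<^sup>2 \<le> 4 * (G * H) * H\<^sup>2" using r by (intro mult_right_mono) auto
    also have "\<dots> \<le> 2 * G\<^sup>2 * H\<^sup>2 + 2 * H^4"
      using mult_nonneg_nonneg[OF zero_le_power2[of H] zero_le_power2[of "G - H"]]
      by (simp add: power2_eq_square power4_eq_xxxx algebra_simps)
    finally show ?thesis .
  qed
  finally show ?thesis by (simp add: G_def H_def r_def)
qed

text \<open>The constant coefficient is separated from the mean-zero rest. The factor q on H^2, the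
  price of a nonzero letter, comes from bounding a single value of the rest by the sum of all q of
  them.\<close>

lemma fourth_moment_one:
  fixes c :: "nat \<Rightarrow> complex"
  assumes "0 < q"
  defines "G \<equiv> (cmod (c 0))\<^sup>2" and "H \<equiv> (\<Sum>t\<in>{1..<q}. (cmod (c t))\<^sup>2)"
  shows "(\<Sum>s<q. cmod (\<Sum>t<q. zeta q ^ (t * s) * c t) ^ 4)
           \<le> real q * (G\<^sup>2 + 8 * G * H + 3 * real q * H\<^sup>2)"
proof -
  define c' where "c' = c(0 := 0)"
  define h where "h s = (\<Sum>t<q. zeta q ^ (t * s) * c' t)" for s
  have set: "{..<q} = insert 0 {1..<q}" using assms(1) by auto
  have split: "(\<Sum>t<q. zeta q ^ (t * s) * c t) = c 0 + h s" for s
    by (simp add: h_def set c'_def)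
  have h2: "(\<Sum>s<q. (cmod (h s))\<^sup>2) = real q * H"
    unfolding h_def parseval_one by (simp add: set c'_def H_def)
  have h4: "(\<Sum>s<q. cmod (h s) ^ 4) \<le> real q * (real q * H\<^sup>2)"
  proof -
    have "(\<Sum>s<q. cmod (h s) ^ 4) \<le> (\<Sum>s<q. (cmod (h s))\<^sup>2 * (real q * H))"
    proof (rule sum_mono)
      fix s assume "s \<in> {..<q}"
      then have "(cmod (h s))\<^sup>2 \<le> real q * H"
        unfolding h2[symmetric] by (intro member_le_sum) auto
      then have "(cmod (h s))\<^sup>2 * (cmod (h s))\<^sup>2 \<le> (cmod (h s))\<^sup>2 * (real q * H)"
        by (intro mult_left_mono) auto
      then show "cmod (h s) ^ 4 \<le> (cmod (h s))\<^sup>2 * (real q * H)"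
        by (simp add: power2_eq_square power4_eq_xxxx mult.assoc)
    qed
    also have "\<dots> = real q * (real q * H\<^sup>2)"
      by (simp only: sum_distrib_right[symmetric] h2) (simp add: power2_eq_square mult_ac)
    finally show ?thesis .
  qed
  have h1: "(\<Sum>s<q. h s) = 0"
  proof -
    have "(\<Sum>s<q. h s) = (\<Sum>t<q. (\<Sum>s<q. zeta q ^ (t * s) * cnj (zeta q ^ (0 * s))) * c' t)"
      unfolding h_def by (subst sum.swap) (simp add: sum_distrib_right)
    also have "\<dots> = (\<Sum>t<q. 0)"
      using assms(1) by (intro sum.cong refl, subst zeta_orthogonal) (auto simp: c'_def)
    finally show ?thesis by simp
  qed
  \<comment> \<open>\<open>R\<close> collects the terms linear in \<open>h\<close>; they sum to zero
    because \<open>h\<close> has no constant coefficient.\<close>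
  define R where "R s = 4 * (cmod (c 0))\<^sup>2 * Re (c 0 * cnj (h s))" for s
  have r: "(\<Sum>s<q. R s) = 0"
  proof -
    have "(\<Sum>s<q. Re (c 0 * cnj (h s))) = Re (c 0 * cnj (\<Sum>s<q. h s))"
      by (simp only: cnj_sum sum_distrib_left Re_sum)
    also have "\<dots> = 0" unfolding h1 by simp
    finally show ?thesis by (simp only: R_def sum_distrib_left[symmetric] mult_zero_right)
  qed
  have "(\<Sum>s<q. cmod (\<Sum>t<q. zeta q ^ (t * s) * c t) ^ 4)
    \<le> (\<Sum>s<q. cmod (c 0) ^ 4 + R s
           + 8 * (cmod (c 0))\<^sup>2 * (cmod (h s))\<^sup>2 + 3 * cmod (h s) ^ 4)"
    unfolding split R_def by (intro sum_mono norm_add_power4)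
  also have "\<dots> = real q * cmod (c 0) ^ 4 + 8 * (cmod (c 0))\<^sup>2 * (real q * H) + 3 * (\<Sum>s<q. cmod (h s) ^ 4)"
    by (simp add: sum.distrib r h2 flip: sum_distrib_left)
  also have "\<dots> \<le> real q * cmod (c 0) ^ 4 + 8 * (cmod (c 0))\<^sup>2 * (real q * H) + 3 * (real q * (real q * H\<^sup>2))"
    using h4 by simp
  also have "\<dots> = real q * (G\<^sup>2 + 8 * G * H + 3 * real q * H\<^sup>2)"
    by (simp add: G_def algebra_simps flip: power_mult)
  finally show ?thesis .
qed

section \<open>Several variables: Parseval and the fourth moment\<close>

text \<open>Values at points whose coordinates are q-th roots of unity, a point being encoded by its
  exponents \<open>x\<close>. The index set is an arbitrary \<open>J\<close>, so that coordinates
  can be removed one at a time.\<close>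

definition cyc_poly :: "nat \<Rightarrow> nat set \<Rightarrow> ((nat \<Rightarrow> nat) \<Rightarrow> complex) \<Rightarrow> (nat \<Rightarrow> nat) \<Rightarrow> complex"
  where "cyc_poly q J a x = (\<Sum>\<alpha>\<in>J \<rightarrow>\<^sub>E {..<q}. a \<alpha> * (\<Prod>i\<in>J. zeta q ^ (\<alpha> i * x i)))"

lemma cyc_poly_cong:
  "(\<And>i. i \<in> J \<Longrightarrow> x i = y i) \<Longrightarrow> cyc_poly q J a x = cyc_poly q J a y"
  by (simp add: cyc_poly_def)

lemma cyc_poly_insert:
  assumes "finite J" "j \<notin> J"
  shows "cyc_poly q (insert j J) a x
    = (\<Sum>t<q. zeta q ^ (t * x j) * cyc_poly q J (\<lambda>\<beta>. a (\<beta>(j := t))) x)"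
proof -
  have "(\<Prod>i\<in>insert j J. zeta q ^ ((\<beta>(j := t)) i * x i)) = zeta q ^ (t * x j) * (\<Prod>i\<in>J. zeta q ^ (\<beta> i * x i))"
    for \<beta> t using assms by (simp, intro disjI2 prod.cong) auto
  then show ?thesis
    by (simp add: cyc_poly_def sum_PiE_insert[OF assms(2)] sum_distrib_left mult_ac)
qed

lemma cyc_poly_insert_upd:
  assumes "finite J" "j \<notin> J"
  shows "cyc_poly q (insert j J) a (x(j := s))
    = (\<Sum>t<q. zeta q ^ (t * s) * cyc_poly q J (\<lambda>\<beta>. a (\<beta>(j := t))) x)"
  unfolding cyc_poly_insert[OF assms] using assms(2)
  by (intro sum.cong refl arg_cong2[where f = "(*)"] cyc_poly_cong) auto

lemma parseval:
  assumes "finite J"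
  shows "(\<Sum>x\<in>J \<rightarrow>\<^sub>E {..<q}. (cmod (cyc_poly q J a x))\<^sup>2)
    = real q ^ card J * (\<Sum>\<alpha>\<in>J \<rightarrow>\<^sub>E {..<q}. (cmod (a \<alpha>))\<^sup>2)"
  using assms
proof (induction J arbitrary: a rule: finite_induct)
  case empty
  then show ?case by (simp add: cyc_poly_def)
next
  case (insert j J)
  have "(\<Sum>x\<in>insert j J \<rightarrow>\<^sub>E {..<q}. (cmod (cyc_poly q (insert j J) a x))\<^sup>2)
    = (\<Sum>x\<in>J \<rightarrow>\<^sub>E {..<q}. \<Sum>s<q. (cmod (\<Sum>t<q. zeta q ^ (t * s) * cyc_poly q J (\<lambda>\<beta>. a (\<beta>(j := t))) x))\<^sup>2)"
    unfolding sum_PiE_insert[OF insert(2)] cyc_poly_insert_upd[OF insert(1,2)] by (rule sum.swap)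
  also have "\<dots> = real q * (\<Sum>t<q. \<Sum>x\<in>J \<rightarrow>\<^sub>E {..<q}. (cmod (cyc_poly q J (\<lambda>\<beta>. a (\<beta>(j := t))) x))\<^sup>2)"
    unfolding parseval_one sum_distrib_left[symmetric] by (subst sum.swap) (rule refl)
  also have "\<dots> = real q ^ card (insert j J) * (\<Sum>\<alpha>\<in>insert j J \<rightarrow>\<^sub>E {..<q}. (cmod (a \<alpha>))\<^sup>2)"
    using insert(1,2) by (simp add: insert.IH sum_PiE_insert sum_distrib_left mult_ac)
  finally show ?case .
qed

text \<open>A squared l2-norm in which each nonzero letter costs 4 sqrt q. The weight is
  multiplicative over the coordinates, which makes the fourth moment bound provable by induction on
  \<open>J\<close>.\<close>

definition cyc_weight :: "nat \<Rightarrow> nat set \<Rightarrow> ((nat \<Rightarrow> nat) \<Rightarrow> complex) \<Rightarrow> real"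
  where "cyc_weight q J a =
    (\<Sum>\<alpha>\<in>J \<rightarrow>\<^sub>E {..<q}. (4 * sqrt (real q)) ^ card {i \<in> J. \<alpha> i \<noteq> 0} * (cmod (a \<alpha>))\<^sup>2)"

lemma cyc_weight_nonneg: "0 \<le> cyc_weight q J a"
  unfolding cyc_weight_def by (intro sum_nonneg) simp

lemma card_supp_upd:
  fixes \<beta> :: "'a \<Rightarrow> nat"
  assumes "finite J" "j \<notin> J"
  shows "card {i \<in> insert j J. (\<beta>(j := t)) i \<noteq> 0} = (if t = 0 then 0 else 1) + card {i \<in> J. \<beta> i \<noteq> 0}"
proof -
  have "{i \<in> insert j J. (\<beta>(j := t)) i \<noteq> 0} = (if t = 0 then {} else {j}) \<union> {i \<in> J. \<beta> i \<noteq> 0}"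
    using assms by auto
  then show ?thesis using assms by (simp add: card_insert_if)
qed

lemma cyc_weight_insert:
  assumes "finite J" "j \<notin> J" "0 < q"
  shows "cyc_weight q (insert j J) a = cyc_weight q J (\<lambda>\<beta>. a (\<beta>(j := 0)))
    + 4 * sqrt (real q) * (\<Sum>t\<in>{1..<q}. cyc_weight q J (\<lambda>\<beta>. a (\<beta>(j := t))))"
proof -
  have set: "{..<q} = insert 0 {1..<q}" using assms(3) by auto
  have "cyc_weight q (insert j J) a = (\<Sum>t\<in>insert 0 {1..<q}. \<Sum>\<beta>\<in>J \<rightarrow>\<^sub>E {..<q}.
    (4 * sqrt (real q)) ^ (if t = 0 then 0 else 1) * ((4 * sqrt (real q)) ^ card {i \<in> J. \<beta> i \<noteq> 0} * (cmod (a (\<beta>(j := t))))\<^sup>2))"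
    unfolding cyc_weight_def sum_PiE_insert[OF assms(2)] set[symmetric]
    by (simp only: card_supp_upd[OF assms(1,2)] power_add mult.assoc)
  then show ?thesis
    by (simp add: cyc_weight_def sum_distrib_left del: sum.op_ivl_Suc)
qed

text \<open>The one-variable estimate is applied in the new coordinate with the slices as
  coefficients; it leaves only products of two squared slices to be summed.\<close>

lemma fourth_moment:
  assumes "finite J" "0 < q"
  shows "(\<Sum>x\<in>J \<rightarrow>\<^sub>E {..<q}. cmod (cyc_poly q J a x) ^ 4) \<le> real q ^ card J * (cyc_weight q J a)\<^sup>2"
  using assms(1)
proof (induction J arbitrary: a rule: finite_induct)
  case empty
  then show ?case by (simp add: cyc_poly_def cyc_weight_def flip: power_mult)
next
  case (insert j J)
  define X where "X = (J \<rightarrow>\<^sub>E {..<q})"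
  define u where "u t x = (cmod (cyc_poly q J (\<lambda>\<beta>. a (\<beta>(j := t))) x))\<^sup>2" for t x
  define w where "w t = cyc_weight q J (\<lambda>\<beta>. a (\<beta>(j := t)))" for t
  define Q where "Q = real q ^ card J"
  define S where "S = (\<Sum>t\<in>{1..<q}. w t)"
  have w0: "0 \<le> w t" for t by (simp add: w_def cyc_weight_nonneg)
  have S0: "0 \<le> S" unfolding S_def by (intro sum_nonneg w0)
  \<comment> \<open>Cauchy-Schwarz turns mixed products into fourth moments of single slices, which
    the induction hypothesis controls.\<close>
  have cross: "(\<Sum>x\<in>X. u s x * u t x) \<le> Q * (w s * w t)" for s t
  proof (rule power2_le_imp_le)
    have u2: "(\<Sum>x\<in>X. (u t x)\<^sup>2) \<le> Q * (w t)\<^sup>2" for t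
      using insert.IH[of "\<lambda>\<beta>. a (\<beta>(j := t))"]
      by (simp add: u_def X_def Q_def w_def flip: power_mult)
    have "(\<Sum>x\<in>X. u s x * u t x)\<^sup>2 \<le> (\<Sum>x\<in>X. (u s x)\<^sup>2) * (\<Sum>x\<in>X. (u t x)\<^sup>2)"
      by (rule Cauchy_Schwarz_ineq_sum)
    also have "\<dots> \<le> (Q * (w s)\<^sup>2) * (Q * (w t)\<^sup>2)"
      by (intro mult_mono u2) (auto intro: sum_nonneg simp: Q_def)
    also have "\<dots> = (Q * (w s * w t))\<^sup>2" by (simp add: power2_eq_square mult_ac)
    finally show "(\<Sum>x\<in>X. u s x * u t x)\<^sup>2 \<le> (Q * (w s * w t))\<^sup>2" .
    show "0 \<le> Q * (w s * w t)" by (simp add: Q_def w0)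
  qed
  have "(\<Sum>x\<in>insert j J \<rightarrow>\<^sub>E {..<q}. cmod (cyc_poly q (insert j J) a x) ^ 4)
    = (\<Sum>x\<in>X. \<Sum>s<q. cmod (\<Sum>t<q. zeta q ^ (t * s) * cyc_poly q J (\<lambda>\<beta>. a (\<beta>(j := t))) x) ^ 4)"
    unfolding sum_PiE_insert[OF insert(2)] cyc_poly_insert_upd[OF insert(1,2)] X_def by (rule sum.swap)
  also have "\<dots> \<le> (\<Sum>x\<in>X. real q * ((u 0 x)\<^sup>2 + 8 * u 0 x * (\<Sum>t\<in>{1..<q}. u t x)
      + 3 * real q * (\<Sum>t\<in>{1..<q}. u t x)\<^sup>2))"
    unfolding u_def by (intro sum_mono fourth_moment_one assms(2))
  also have "\<dots> = real q * ((\<Sum>x\<in>X. u 0 x * u 0 x) + 8 * (\<Sum>t\<in>{1..<q}. \<Sum>x\<in>X. u 0 x * u t x)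
      + 3 * real q * (\<Sum>s\<in>{1..<q}. \<Sum>t\<in>{1..<q}. \<Sum>x\<in>X. u s x * u t x))"
  proof -
    have 1: "(\<Sum>x\<in>X. 8 * u 0 x * (\<Sum>t\<in>{1..<q}. u t x)) = 8 * (\<Sum>t\<in>{1..<q}. \<Sum>x\<in>X. u 0 x * u t x)"
      by (subst sum.swap) (simp add: sum_distrib_left mult_ac)
    have "(\<Sum>x\<in>X. (\<Sum>t\<in>{1..<q}. u t x)\<^sup>2) = (\<Sum>s\<in>{1..<q}. \<Sum>x\<in>X. \<Sum>t\<in>{1..<q}. u s x * u t x)"
      by (subst sum.swap) (simp add: power2_eq_square sum_product)
    also have "\<dots> = (\<Sum>s\<in>{1..<q}. \<Sum>t\<in>{1..<q}. \<Sum>x\<in>X. u s x * u t x)"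
      by (intro sum.cong refl sum.swap)
    finally show ?thesis
      by (simp only: sum_distrib_left[symmetric] sum.distrib 1) (simp add: power2_eq_square)
  qed
  also have "\<dots> \<le> real q * (Q * (w 0 * w 0) + 8 * (\<Sum>t\<in>{1..<q}. Q * (w 0 * w t))
      + 3 * real q * (\<Sum>s\<in>{1..<q}. \<Sum>t\<in>{1..<q}. Q * (w s * w t)))"
    by (intro mult_left_mono add_mono sum_mono cross) auto
  also have "\<dots> = real q * Q * ((w 0)\<^sup>2 + 8 * w 0 * S + 3 * real q * S\<^sup>2)"
    by (simp add: S_def sum_distrib_left[symmetric] sum_distrib_right[symmetric] power2_eq_square algebra_simps)
  \<comment> \<open>The weight 4 sqrt q is made for this square: its cross term 8 sqrt q dominates
    8, and its last term 16 q dominates 3 q.\<close>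
  also have "\<dots> \<le> real q * Q * ((w 0 + 4 * sqrt (real q) * S)\<^sup>2)"
  proof (rule mult_left_mono)
    have "1 \<le> sqrt (real q)" using assms(2) by simp
    then have "8 * w 0 * S * 1 \<le> 8 * w 0 * S * sqrt (real q)"
      using w0 S0 by (intro mult_left_mono) auto
    moreover have "(w 0 + 4 * sqrt (real q) * S)\<^sup>2 = (w 0)\<^sup>2 + 8 * w 0 * S * sqrt (real q) + 16 * real q * S\<^sup>2"
      by (simp add: power2_eq_square algebra_simps)
    moreover have "3 * real q * S\<^sup>2 \<le> 16 * real q * S\<^sup>2" by (intro mult_right_mono) auto
    ultimately show "(w 0)\<^sup>2 + 8 * w 0 * S + 3 * real q * S\<^sup>2 \<le> (w 0 + 4 * sqrt (real q) * S)\<^sup>2"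
      by linarith
  qed (simp add: Q_def)
  also have "\<dots> = real q ^ card (insert j J) * (cyc_weight q (insert j J) a)\<^sup>2"
    using insert(1,2) by (simp add: cyc_weight_insert assms(2) Q_def w_def S_def)
  finally show ?case .
qed

section \<open>Comparison of the L2-norm with the L1-norm\<close>

text \<open>L2 is interpolated between L1 and L4: Cauchy-Schwarz is used once for \<open>m2\<close>
  against \<open>m1\<close>, \<open>m3\<close> and once for \<open>m3\<close> against
  \<open>m2\<close>, \<open>m4\<close>; then \<open>m3\<close> is eliminated and one factor
  \<open>m2\<close> cancelled.\<close>

lemma second_moment_le:
  fixes f :: "'a \<Rightarrow> real"
  assumes "\<And>x. x \<in> X \<Longrightarrow> 0 \<le> f x"
  shows "(\<Sum>x\<in>X. (f x)\<^sup>2) ^ 3 \<le> (\<Sum>x\<in>X. f x)\<^sup>2 * (\<Sum>x\<in>X. f x ^ 4)"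
proof -
  define m1 m2 m3 m4 where "m1 = (\<Sum>x\<in>X. f x)" and "m2 = (\<Sum>x\<in>X. (f x)\<^sup>2)"
    and "m3 = (\<Sum>x\<in>X. f x ^ 3)" and "m4 = (\<Sum>x\<in>X. f x ^ 4)"
  have nonneg: "0 \<le> m1" "0 \<le> m2" "0 \<le> m3" "0 \<le> m4"
    by (auto simp: m1_def m2_def m3_def m4_def assms intro!: sum_nonneg)
  have a: "m2\<^sup>2 \<le> m1 * m3"
  proof -
    have "m2\<^sup>2 = (\<Sum>x\<in>X. sqrt (f x) * (sqrt (f x) * f x))\<^sup>2"
      unfolding m2_def using assms
      by (intro arg_cong[where f = "\<lambda>x. x\<^sup>2"] sum.cong refl) (simp add: power2_eq_square flip: mult.assoc)
    also have "\<dots> \<le> (\<Sum>x\<in>X. (sqrt (f x))\<^sup>2) * (\<Sum>x\<in>X. (sqrt (f x) * f x)\<^sup>2)"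
      by (rule Cauchy_Schwarz_ineq_sum)
    also have "\<dots> = m1 * m3"
      using assms by (simp add: m1_def m3_def power_mult_distrib power3_eq_cube power2_eq_square mult_ac)
    finally show ?thesis .
  qed
  have b: "m3\<^sup>2 \<le> m2 * m4"
  proof -
    have "m3\<^sup>2 = (\<Sum>x\<in>X. f x * (f x)\<^sup>2)\<^sup>2"
      by (simp add: m3_def power3_eq_cube power2_eq_square mult_ac)
    also have "\<dots> \<le> (\<Sum>x\<in>X. (f x)\<^sup>2) * (\<Sum>x\<in>X. ((f x)\<^sup>2)\<^sup>2)" by (rule Cauchy_Schwarz_ineq_sum)
    finally show ?thesis by (simp add: m2_def m4_def flip: power_mult)
  qed
  have "m2 * m2 ^ 3 = (m2\<^sup>2)\<^sup>2" by (simp add: power2_eq_square power3_eq_cube mult_ac)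
  also have "\<dots> \<le> (m1 * m3)\<^sup>2" using a by (intro power_mono) auto
  also have "\<dots> = m1\<^sup>2 * m3\<^sup>2" by (simp add: power_mult_distrib)
  also have "\<dots> \<le> m1\<^sup>2 * (m2 * m4)" using b by (intro mult_left_mono) auto
  finally have "m2 * m2 ^ 3 \<le> m2 * (m1\<^sup>2 * m4)" by (simp add: mult_ac)
  then have "m2 ^ 3 \<le> m1\<^sup>2 * m4"
    using nonneg by (cases "m2 = 0") auto
  then show ?thesis by (simp add: m1_def m2_def m4_def)
qed

text \<open>With at most k nonzero letters the weight is at most (4 sqrt q)^k times the plain
  squared norm, so the interpolation inequality can be solved for the second moment. Sums over
  \<open>x\<close> are not normalised, hence the power of q on the left.\<close>

lemma hypercontractive:
  assumes "finite J" "0 < q"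
    and supp: "\<And>\<alpha>. \<alpha> \<in> J \<rightarrow>\<^sub>E {..<q} \<Longrightarrow> a \<alpha> \<noteq> 0 \<Longrightarrow> card {i \<in> J. \<alpha> i \<noteq> 0} \<le> k"
  shows "real q ^ card J * sqrt (\<Sum>\<alpha>\<in>J \<rightarrow>\<^sub>E {..<q}. (cmod (a \<alpha>))\<^sup>2)
    \<le> (4 * sqrt (real q)) ^ k * (\<Sum>x\<in>J \<rightarrow>\<^sub>E {..<q}. cmod (cyc_poly q J a x))"
proof -
  define L where "L = 4 * sqrt (real q)"
  define Q where "Q = real q ^ card J"
  define A where "A = (\<Sum>\<alpha>\<in>J \<rightarrow>\<^sub>E {..<q}. (cmod (a \<alpha>))\<^sup>2)"
  define m where "m = (\<Sum>x\<in>J \<rightarrow>\<^sub>E {..<q}. cmod (cyc_poly q J a x))"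
  have "1 \<le> sqrt (real q)" using assms(2) by simp
  then have L: "1 \<le> L" unfolding L_def by linarith
  have Q: "0 < Q" using assms(2) by (simp add: Q_def)
  have A: "0 \<le> A" unfolding A_def by (intro sum_nonneg) simp
  have m: "0 \<le> m" unfolding m_def by (intro sum_nonneg) simp
  have "cyc_weight q J a \<le> L ^ k * A"
    unfolding cyc_weight_def A_def sum_distrib_left L_def[symmetric]
  proof (rule sum_mono)
    fix \<alpha> assume \<alpha>: "\<alpha> \<in> J \<rightarrow>\<^sub>E {..<q}"
    show "L ^ card {i \<in> J. \<alpha> i \<noteq> 0} * (cmod (a \<alpha>))\<^sup>2 \<le> L ^ k * (cmod (a \<alpha>))\<^sup>2"
      using supp[OF \<alpha>] L by (cases "a \<alpha> = 0") (auto intro!: mult_right_mono power_increasing)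
  qed
  then have W: "(cyc_weight q J a)\<^sup>2 \<le> (L ^ k * A)\<^sup>2"
    by (intro power_mono cyc_weight_nonneg)
  have "(Q * A) ^ 3 \<le> m\<^sup>2 * (\<Sum>x\<in>J \<rightarrow>\<^sub>E {..<q}. cmod (cyc_poly q J a x) ^ 4)"
    using second_moment_le[of "J \<rightarrow>\<^sub>E {..<q}" "\<lambda>x. cmod (cyc_poly q J a x)"]
    by (simp add: parseval[OF assms(1)] Q_def A_def m_def)
  also have "\<dots> \<le> m\<^sup>2 * (Q * (cyc_weight q J a)\<^sup>2)"
    unfolding Q_def by (intro mult_left_mono fourth_moment assms) auto
  also have "\<dots> \<le> m\<^sup>2 * (Q * (L ^ k * A)\<^sup>2)"
    using W Q by (intro mult_left_mono) auto
  finally have "(Q * A\<^sup>2) * (Q\<^sup>2 * A) \<le> (Q * A\<^sup>2) * (L ^ k * m)\<^sup>2"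
    by (simp add: power_mult_distrib power2_eq_square power3_eq_cube mult_ac)
  then have "Q\<^sup>2 * A \<le> (L ^ k * m)\<^sup>2"
    using Q A by (cases "A = 0") (auto simp: mult_le_cancel_left_pos)
  then have "sqrt (Q\<^sup>2 * A) \<le> L ^ k * m"
    using L m by (intro real_le_lsqrt) auto
  then show ?thesis using Q by (simp add: real_sqrt_mult Q_def A_def L_def m_def)
qed

section \<open>Increments and slices at a fixed point\<close>

lemma sum_increments_bound:
  assumes J: "finite J"
    and supp: "\<And>\<alpha>. \<alpha> \<in> J \<rightarrow>\<^sub>E {..<q} \<Longrightarrow> a \<alpha> \<noteq> 0 \<Longrightarrow> card {i \<in> J. \<alpha> i \<noteq> 0} \<le> d"
    and bound: "\<And>x. x \<in> J \<rightarrow>\<^sub>E {..<q} \<Longrightarrow> cmod (cyc_poly q J a x) \<le> M"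
    and x: "x \<in> J \<rightarrow>\<^sub>E {..<q}" and y: "\<And>j. j \<in> J \<Longrightarrow> y j < q"
  shows "cmod (\<Sum>j\<in>J. cyc_poly q J a (x(j := y j)) - cyc_poly q J a x) \<le> 2 * 5 ^ d * M"
proof -
  define X where "X = J \<rightarrow>\<^sub>E {..<q}"
  define u where "u \<alpha> j = zeta q ^ (\<alpha> j * x j)" for \<alpha> j
  define v where "v \<alpha> j = zeta q ^ (\<alpha> j * y j)" for \<alpha> j
  \<comment> \<open>At t this is the expectation of the polynomial when each coordinate of
    \<open>x\<close> is independently replaced by that of \<open>y\<close> with probability
    t.\<close>
  define p where "p = (\<Sum>\<alpha>\<in>X. smult (a \<alpha>) (\<Prod>j\<in>J. [:u \<alpha> j, v \<alpha> j - u \<alpha> j:]))"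
  have finX: "finite X" unfolding X_def using J by (intro finite_PiE) auto
  have "degree p \<le> d"
    unfolding p_def
  proof (rule degree_sum_le[OF finX])
    fix \<alpha> assume \<alpha>: "\<alpha> \<in> X"
    show "degree (smult (a \<alpha>) (\<Prod>j\<in>J. [:u \<alpha> j, v \<alpha> j - u \<alpha> j:])) \<le> d"
    proof (cases "a \<alpha> = 0")
      case False
      have "degree (\<Prod>j\<in>J. [:u \<alpha> j, v \<alpha> j - u \<alpha> j:]) \<le> (\<Sum>j\<in>J. degree [:u \<alpha> j, v \<alpha> j - u \<alpha> j:])"
        using degree_prod_sum_le[OF J, of "\<lambda>j. [:u \<alpha> j, v \<alpha> j - u \<alpha> j:]"] unfolding comp_def .
      also have "\<dots> \<le> (\<Sum>j\<in>J. if \<alpha> j \<noteq> 0 then 1 else 0)"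
        \<comment> \<open>A zero letter gives u = v = 1, hence a constant factor, so the degree
          counts only the support.\<close>
        by (intro sum_mono) (auto simp: u_def v_def)
      also have "\<dots> = card {i \<in> J. \<alpha> i \<noteq> 0}"
        using J by (simp add: sum.If_cases Int_def)
      also have "\<dots> \<le> d" using supp \<alpha> False by (simp add: X_def)
      finally show ?thesis using order_trans[OF degree_smult_le] by blast
    qed simp
  qed
  moreover have "cmod (poly p (of_real t)) \<le> M" if t: "0 \<le> t" "t \<le> 1" for t
  proof -
    define mix where "mix S = (\<lambda>j. if j \<in> S then y j else x j)" for S
    have mix: "cyc_poly q J a (mix S) = (\<Sum>\<alpha>\<in>X. a \<alpha> * ((\<Prod>j\<in>S. v \<alpha> j) * (\<Prod>j\<in>J-S. u \<alpha> j)))"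
      if "S \<subseteq> J" for S
    proof -
      have "(\<Prod>j\<in>J. zeta q ^ (\<alpha> j * mix S j)) = (\<Prod>j\<in>S. v \<alpha> j) * (\<Prod>j\<in>J-S. u \<alpha> j)" for \<alpha>
        using prod.subset_diff[OF that J, of "\<lambda>j. zeta q ^ (\<alpha> j * mix S j)"]
        by (simp add: mix_def u_def v_def mult.commute)
      then show ?thesis by (simp add: cyc_poly_def X_def)
    qed
    have "poly p (of_real t) = (\<Sum>\<alpha>\<in>X. a \<alpha> * (\<Prod>j\<in>J. of_real t * v \<alpha> j + of_real (1 - t) * u \<alpha> j))"
      by (simp add: p_def poly_sum poly_prod algebra_simps)
    \<comment> \<open>Expanding over the set S of replaced coordinates exhibits a convex combination
      of grid values: the weights sum to a product of factors t + (1 - t).\<close>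
    also have "\<dots> = (\<Sum>\<alpha>\<in>X. \<Sum>S\<in>Pow J. a \<alpha> * ((\<Prod>j\<in>S. of_real t * v \<alpha> j) * (\<Prod>j\<in>J-S. of_real (1 - t) * u \<alpha> j)))"
      unfolding prod_add[OF J] sum_distrib_left by simp
    also have "\<dots> = (\<Sum>S\<in>Pow J. \<Sum>\<alpha>\<in>X. a \<alpha> * ((\<Prod>j\<in>S. of_real t * v \<alpha> j) * (\<Prod>j\<in>J-S. of_real (1 - t) * u \<alpha> j)))"
      by (rule sum.swap)
    also have "\<dots> = (\<Sum>S\<in>Pow J. of_real (t ^ card S * (1 - t) ^ card (J - S)) * cyc_poly q J a (mix S))"
      by (intro sum.cong refl) (simp add: mix prod.distrib sum_distrib_left mult_ac)
    also have "cmod \<dots> \<le> (\<Sum>S\<in>Pow J. t ^ card S * (1 - t) ^ card (J - S) * M)"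
    proof (rule sum_norm_le)
      fix S assume S: "S \<in> Pow J"
      have "mix S \<in> X" using x y S by (auto simp: mix_def X_def PiE_iff extensional_def)
      then have "cmod (cyc_poly q J a (mix S)) \<le> M" using bound by (simp add: X_def)
      then show "cmod (of_real (t ^ card S * (1 - t) ^ card (J - S)) * cyc_poly q J a (mix S))
        \<le> t ^ card S * (1 - t) ^ card (J - S) * M"
        using t unfolding norm_mult norm_of_real
        by (intro mult_mono) auto
    qed
    also have "\<dots> = (\<Prod>j\<in>J. t + (1 - t)) * M"
      unfolding prod_add[OF J] sum_distrib_right by simp
    finally show ?thesis by simp
  qed
  ultimately have "cmod (coeff p 1) \<le> 2 * 5 ^ d * M" by (rule coeff_1_bound)
  moreover have "coeff p 1 = (\<Sum>j\<in>J. cyc_poly q J a (x(j := y j)) - cyc_poly q J a x)"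
  proof -
    \<comment> \<open>The linear coefficient is the derivative at 0, and the product rule replaces
      one coordinate at a time.\<close>
    have "coeff p 1 = poly (pderiv p) 0" by (simp add: poly_0_coeff_0 coeff_pderiv)
    also have "\<dots> = (\<Sum>\<alpha>\<in>X. a \<alpha> * (\<Sum>j\<in>J. (\<Prod>i\<in>J - {j}. u \<alpha> i) * (v \<alpha> j - u \<alpha> j)))"
      by (simp add: p_def higher_pderiv_sum[of 1, simplified] pderiv_smult pderiv_prod poly_sum poly_prod pderiv_pCons mult.commute)
    also have "\<dots> = (\<Sum>j\<in>J. \<Sum>\<alpha>\<in>X. a \<alpha> * ((\<Prod>i\<in>J - {j}. u \<alpha> i) * (v \<alpha> j - u \<alpha> j)))"
      unfolding sum_distrib_left by (rule sum.swap)
    also have "\<dots> = (\<Sum>j\<in>J. cyc_poly q J a (x(j := y j)) - cyc_poly q J a x)"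
    proof (rule sum.cong[OF refl])
      fix j assume j: "j \<in> J"
      have "(\<Prod>i\<in>J. zeta q ^ (\<alpha> i * (x(j := y j)) i)) = v \<alpha> j * (\<Prod>i\<in>J - {j}. u \<alpha> i)"
        "(\<Prod>i\<in>J. zeta q ^ (\<alpha> i * x i)) = u \<alpha> j * (\<Prod>i\<in>J - {j}. u \<alpha> i)" for \<alpha>
        by (simp_all add: prod.remove[OF J j] u_def v_def)
      then show "(\<Sum>\<alpha>\<in>X. a \<alpha> * ((\<Prod>i\<in>J - {j}. u \<alpha> i) * (v \<alpha> j - u \<alpha> j)))
        = cyc_poly q J a (x(j := y j)) - cyc_poly q J a x"
        by (simp add: cyc_poly_def X_def[symmetric] sum_subtractf[symmetric] algebra_simps)
    qed
    finally show ?thesis .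
  qed
  ultimately show ?thesis by simp
qed

text \<open>Choosing \<open>y = x\<close> outside a subset bounds every partial sum of the
  increments; for complex numbers this bounds the sum of the moduli at the cost of a factor 2 * 2,
  which turns 2 into 8.\<close>

lemma sum_norm_increments_bound:
  assumes J: "finite J"
    and supp: "\<And>\<alpha>. \<alpha> \<in> J \<rightarrow>\<^sub>E {..<q} \<Longrightarrow> a \<alpha> \<noteq> 0 \<Longrightarrow> card {i \<in> J. \<alpha> i \<noteq> 0} \<le> d"
    and bound: "\<And>x. x \<in> J \<rightarrow>\<^sub>E {..<q} \<Longrightarrow> cmod (cyc_poly q J a x) \<le> M"
    and x: "x \<in> J \<rightarrow>\<^sub>E {..<q}" and y: "\<And>j. j \<in> J \<Longrightarrow> y j < q"
  shows "(\<Sum>j\<in>J. cmod (cyc_poly q J a (x(j := y j)) - cyc_poly q J a x)) \<le> 8 * 5 ^ d * M"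
proof -
  have "(\<Sum>j\<in>J. cmod (cyc_poly q J a (x(j := y j)) - cyc_poly q J a x))
    \<le> 2 * real DIM(complex) * (2 * 5 ^ d * M)"
  proof (rule sum_norm_allsubsets_bound[OF J])
    fix S assume S: "S \<subseteq> J"
    define z where "z j = (if j \<in> S then y j else x j)" for j
    have "(\<Sum>j\<in>S. cyc_poly q J a (x(j := y j)) - cyc_poly q J a x)
      = (\<Sum>j\<in>J. cyc_poly q J a (x(j := z j)) - cyc_poly q J a x)"
      using S J by (intro sum.mono_neutral_cong_left) (auto simp: z_def)
    also have "cmod \<dots> \<le> 2 * 5 ^ d * M"
      using x y by (intro sum_increments_bound assms) (auto simp: z_def PiE_iff)
    finally show "cmod (\<Sum>j\<in>S. cyc_poly q J a (x(j := y j)) - cyc_poly q J a x) \<le> 2 * 5 ^ d * M" .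
  qed
  then show ?thesis by simp
qed

text \<open>As a function of the new value s of coordinate j, the increment is a one-variable
  polynomial whose nonconstant coefficients are the slices. By Parseval some s makes it at least as
  large as the l2-norm of the slices over t; Cauchy-Schwarz over t then costs sqrt q.\<close>

lemma sum_norm_slices_bound:
  assumes J: "finite J" and q: "0 < q"
    and supp: "\<And>\<alpha>. \<alpha> \<in> J \<rightarrow>\<^sub>E {..<q} \<Longrightarrow> a \<alpha> \<noteq> 0 \<Longrightarrow> card {i \<in> J. \<alpha> i \<noteq> 0} \<le> d"
    and bound: "\<And>x. x \<in> J \<rightarrow>\<^sub>E {..<q} \<Longrightarrow> cmod (cyc_poly q J a x) \<le> M"
    and x: "x \<in> J \<rightarrow>\<^sub>E {..<q}"
  shows "(\<Sum>j\<in>J. \<Sum>t\<in>{1..<q}. cmod (cyc_poly q (J - {j}) (\<lambda>\<beta>. a (\<beta>(j := t))) x))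
    \<le> sqrt (real q) * (8 * 5 ^ d * M)"
proof -
  define F where "F j t = cyc_poly q (J - {j}) (\<lambda>\<beta>. a (\<beta>(j := t))) x" for j t
  have set: "{..<q} = insert 0 {1..<q}" using q by auto
  have "\<exists>s<q. (\<Sum>t\<in>{1..<q}. (cmod (F j t))\<^sup>2) \<le> (cmod (cyc_poly q J a (x(j := s)) - cyc_poly q J a x))\<^sup>2"
    if j: "j \<in> J" for j
  proof (rule ccontr)
    assume "\<not> ?thesis"
    then have less: "(cmod (cyc_poly q J a (x(j := s)) - cyc_poly q J a x))\<^sup>2 < (\<Sum>t\<in>{1..<q}. (cmod (F j t))\<^sup>2)"
      if "s < q" for s using that not_le by blast
    \<comment> \<open>Subtracting the value at \<open>x\<close> changes only the coefficient at t =
      0.\<close>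
    define c where "c t = F j t - (if t = 0 then cyc_poly q J a x else 0)" for t
    have J': "finite (J - {j})" "j \<notin> J - {j}" "insert j (J - {j}) = J" using J j by auto
    have c: "cyc_poly q J a (x(j := s)) - cyc_poly q J a x = (\<Sum>t<q. zeta q ^ (t * s) * c t)" for s
    proof -
      have "(\<Sum>t<q. zeta q ^ (t * s) * c t)
        = (\<Sum>t<q. zeta q ^ (t * s) * F j t - (if t = 0 then cyc_poly q J a x else 0))"
        by (intro sum.cong refl) (auto simp: c_def algebra_simps)
      also have "\<dots> = (\<Sum>t<q. zeta q ^ (t * s) * F j t) - cyc_poly q J a x"
        using q by (simp add: sum_subtractf)
      finally show ?thesis
        using cyc_poly_insert_upd[OF J'(1,2), of q a x s] unfolding J'(3) F_def by simp
    qed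
    have "real q * (\<Sum>t\<in>{1..<q}. (cmod (F j t))\<^sup>2) \<le> real q * (\<Sum>t<q. (cmod (c t))\<^sup>2)"
      by (intro mult_left_mono) (auto simp: set c_def)
    also have "\<dots> = (\<Sum>s<q. (cmod (cyc_poly q J a (x(j := s)) - cyc_poly q J a x))\<^sup>2)"
      unfolding c by (rule parseval_one[symmetric])
    also have "\<dots> < (\<Sum>s<q. \<Sum>t\<in>{1..<q}. (cmod (F j t))\<^sup>2)"
      using q by (intro sum_strict_mono less) auto
    finally show False by simp
  qed
  then obtain y where y: "\<And>j. j \<in> J \<Longrightarrow> y j < q"
    "\<And>j. j \<in> J \<Longrightarrow> (\<Sum>t\<in>{1..<q}. (cmod (F j t))\<^sup>2) \<le> (cmod (cyc_poly q J a (x(j := y j)) - cyc_poly q J a x))\<^sup>2"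
    by metis
  have "(\<Sum>t\<in>{1..<q}. cmod (F j t)) \<le> sqrt (real q) * cmod (cyc_poly q J a (x(j := y j)) - cyc_poly q J a x)"
    if j: "j \<in> J" for j
  proof (rule power2_le_imp_le)
    have "(\<Sum>t\<in>{1..<q}. cmod (F j t))\<^sup>2 \<le> (\<Sum>t\<in>{1..<q}. (cmod (F j t))\<^sup>2) * card {1..<q}"
      by (rule sum_squared_le_sum_of_squares)
    also have "\<dots> \<le> (cmod (cyc_poly q J a (x(j := y j)) - cyc_poly q J a x))\<^sup>2 * real q"
      using y(2)[OF j] by (intro mult_mono) auto
    finally show "(\<Sum>t\<in>{1..<q}. cmod (F j t))\<^sup>2
      \<le> (sqrt (real q) * cmod (cyc_poly q J a (x(j := y j)) - cyc_poly q J a x))\<^sup>2"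
      by (simp add: power_mult_distrib mult.commute)
  qed simp
  then have "(\<Sum>j\<in>J. \<Sum>t\<in>{1..<q}. cmod (F j t))
    \<le> (\<Sum>j\<in>J. sqrt (real q) * cmod (cyc_poly q J a (x(j := y j)) - cyc_poly q J a x))"
    by (intro sum_mono) auto
  also have "\<dots> \<le> sqrt (real q) * (8 * 5 ^ d * M)"
    unfolding sum_distrib_left[symmetric]
    by (intro mult_left_mono sum_norm_increments_bound assms y) auto
  finally show ?thesis by (simp add: F_def)
qed

text \<open>Hypercontractivity replaces each letter norm by an average over x of the modulus of a
  slice; after exchanging the sums, the slice bound applies at every single x.\<close>

lemma sum_letter_norms_bound:
  assumes J: "finite J" and q: "0 < q" and d: "1 \<le> d"
    and supp: "\<And>\<alpha>. \<alpha> \<in> J \<rightarrow>\<^sub>E {..<q} \<Longrightarrow> a \<alpha> \<noteq> 0 \<Longrightarrow> card {i \<in> J. \<alpha> i \<noteq> 0} \<le> d"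
    and bound: "\<And>x. x \<in> J \<rightarrow>\<^sub>E {..<q} \<Longrightarrow> cmod (cyc_poly q J a x) \<le> M"
  shows "(\<Sum>j\<in>J. \<Sum>t\<in>{1..<q}. sqrt (\<Sum>\<beta>\<in>J - {j} \<rightarrow>\<^sub>E {..<q}. (cmod (a (\<beta>(j := t))))\<^sup>2))
    \<le> 8 * (20 * sqrt (real q)) ^ d * M"
proof -
  define Q where "Q = real q ^ card J"
  \<comment> \<open>Fixing a nonzero letter uses up one element of the support, hence d - 1; the
    factor sqrt q saved here is spent by the slice bound.\<close>
  define L where "L = (4 * sqrt (real q)) ^ (d - 1)"
  define X where "X = J \<rightarrow>\<^sub>E {..<q}"
  define F where "F j t x = cmod (cyc_poly q (J - {j}) (\<lambda>\<beta>. a (\<beta>(j := t))) x)" for j t x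
  define f where "f j t = sqrt (\<Sum>\<beta>\<in>J - {j} \<rightarrow>\<^sub>E {..<q}. (cmod (a (\<beta>(j := t))))\<^sup>2)" for j t
  have Q: "0 < Q" using q by (simp add: Q_def)
  have L: "0 \<le> L" by (simp add: L_def)
  have "X \<noteq> {}" using q by (auto simp: X_def PiE_eq_empty_iff)
  then obtain x0 where "x0 \<in> X" by blast
  then have M: "0 \<le> M" using order_trans[OF norm_ge_zero bound[of x0]] by (simp add: X_def)
  have letter: "Q * f j t \<le> L * (\<Sum>x\<in>X. F j t x)" if j: "j \<in> J" and t: "t \<in> {1..<q}" for j t
  proof -
    have J': "finite (J - {j})" "j \<notin> J - {j}" "insert j (J - {j}) = J" using J j by auto
    have card: "card J = Suc (card (J - {j}))" by (rule card.remove[OF J j])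
    have "card {i \<in> J - {j}. \<beta> i \<noteq> 0} \<le> d - 1"
      if "\<beta> \<in> J - {j} \<rightarrow>\<^sub>E {..<q}" "a (\<beta>(j := t)) \<noteq> 0" for \<beta>
    proof -
      have "\<beta>(j := t) \<in> J \<rightarrow>\<^sub>E {..<q}"
        using PiE_fun_upd[OF _ that(1), of t j] t unfolding J'(3) by simp
      then have "card {i \<in> J. (\<beta>(j := t)) i \<noteq> 0} \<le> d" using supp that(2) by blast
      then show ?thesis using card_supp_upd[OF J'(1,2), of \<beta> t] t unfolding J'(3) by simp
    qed
    then have "real q ^ card (J - {j}) * f j t \<le> L * (\<Sum>x\<in>J - {j} \<rightarrow>\<^sub>E {..<q}. F j t x)"
      unfolding f_def F_def L_def by (intro hypercontractive J' q)
    \<comment> \<open>A slice ignores coordinate j, so summing it over the full grid repeats each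
      value q times.\<close>
    then have "real q * (real q ^ card (J - {j}) * f j t) \<le> real q * (L * (\<Sum>x\<in>J - {j} \<rightarrow>\<^sub>E {..<q}. F j t x))"
      by (intro mult_left_mono) auto
    also have "\<dots> = L * (\<Sum>x\<in>X. F j t x)"
    proof -
      have "F j t (x(j := s)) = F j t x" for x s
        unfolding F_def by (intro arg_cong[where f = cmod] cyc_poly_cong) auto
      then have "(\<Sum>x\<in>insert j (J - {j}) \<rightarrow>\<^sub>E {..<q}. F j t x) = real q * (\<Sum>x\<in>J - {j} \<rightarrow>\<^sub>E {..<q}. F j t x)"
        unfolding sum_PiE_insert[OF J'(2)] by simp
      then show ?thesis unfolding J'(3) X_def by simp
    qed
    finally show ?thesis by (simp add: Q_def card)
  qed
  have "Q * (\<Sum>j\<in>J. \<Sum>t\<in>{1..<q}. f j t) \<le> (\<Sum>j\<in>J. \<Sum>t\<in>{1..<q}. L * (\<Sum>x\<in>X. F j t x))"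
    unfolding sum_distrib_left by (intro sum_mono letter[unfolded sum_distrib_left])
  also have "\<dots> = L * (\<Sum>j\<in>J. \<Sum>x\<in>X. \<Sum>t\<in>{1..<q}. F j t x)"
    unfolding sum_distrib_left[symmetric] by (intro arg_cong[where f = "(*) L"] sum.cong refl sum.swap)
  also have "\<dots> = L * (\<Sum>x\<in>X. \<Sum>j\<in>J. \<Sum>t\<in>{1..<q}. F j t x)"
    by (intro arg_cong[where f = "(*) L"] sum.swap)
  also have "\<dots> \<le> L * (\<Sum>x\<in>X. sqrt (real q) * (8 * 5 ^ d * M))"
    unfolding F_def X_def by (intro mult_left_mono sum_mono sum_norm_slices_bound assms L) auto
  also have "\<dots> = Q * (L * sqrt (real q) * (8 * 5 ^ d * M))"
    using J by (simp add: X_def card_PiE Q_def)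
  finally have "(\<Sum>j\<in>J. \<Sum>t\<in>{1..<q}. f j t) \<le> L * sqrt (real q) * (8 * 5 ^ d * M)"
    using Q by (simp only: mult_le_cancel_left_pos)
  also have "\<dots> \<le> (4 * sqrt (real q)) ^ d * (8 * 5 ^ d * M)"
  proof (rule mult_right_mono)
    have "(4 * sqrt (real q)) ^ d = L * (4 * sqrt (real q))"
      unfolding L_def by (rule power_minus_mult[symmetric]) (use d in simp)
    then show "L * sqrt (real q) \<le> (4 * sqrt (real q)) ^ d" using L by simp
  qed (use M in simp)
  also have "\<dots> = 8 * (20 * sqrt (real q)) ^ d * M"
  proof -
    have "(20 * sqrt (real q)) ^ d = (5 * (4 * sqrt (real q))) ^ d" by simp
    also have "\<dots> = 5 ^ d * (4 * sqrt (real q)) ^ d" by (rule power_mult_distrib)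
    finally show ?thesis by (simp only: mult_ac)
  qed
  finally show ?thesis by (simp add: f_def)
qed

section \<open>The Blei-type inequality\<close>

text \<open>
  AM-GM for the \<open>d + 1\<close> numbers \<open>c\<^sup>2 / g\<^sub>j\<close>, \<open>c\<^sup>2\<close> (taken \<open>d - |S|\<close> times) and \<open>\<Prod> g\<^sub>j\<close>,
  whose product is \<open>c\<^bsup>2d\<^esup>\<close>.
\<close>

lemma powr_le_weighted_sum:
  assumes "finite S" "card S \<le> d" "0 < c" "\<And>j. j \<in> S \<Longrightarrow> 0 < g j"
  shows "(real d + 1) * c powr (2 * real d / (real d + 1))
    \<le> (\<Sum>j\<in>S. c\<^sup>2 / g j) + real d * c\<^sup>2 + (\<Prod>j\<in>S. g j)"
proof -
  define G where "G = c powr (2 * real d / (real d + 1))"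
  have G: "0 < G" using assms(3) by (simp add: G_def)
  have lnG: "(real d + 1) * ln G = 2 * real d * ln c"
    using assms(3) by (simp add: G_def ln_powr)
  \<comment> \<open>Each of the d + 1 numbers is compared with their geometric mean \<open>G\<close>
    by the tangent line of the logarithm; this is AM-GM in additive form.\<close>
  have tangent: "G * (1 + ln y - ln G) \<le> y" if "0 < y" for y
  proof -
    have "ln (y / G) \<le> y / G - 1" using that G by (intro ln_le_minus_one) simp
    then show ?thesis using that G by (simp add: ln_div field_simps)
  qed
  have lnc: "ln (c\<^sup>2) = 2 * ln c" using assms(3) by (simp add: ln_realpow)
  have "(\<Sum>j\<in>S. c\<^sup>2 / g j) \<ge> (\<Sum>j\<in>S. G * (1 + ln (c\<^sup>2 / g j) - ln G))"
    using assms by (intro sum_mono tangent) simp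
  also have "(\<Sum>j\<in>S. G * (1 + ln (c\<^sup>2 / g j) - ln G))
    = (\<Sum>j\<in>S. G * (1 + 2 * ln c - ln G) - G * ln (g j))"
  proof (rule sum.cong[OF refl])
    fix j assume "j \<in> S"
    then have "ln (c\<^sup>2 / g j) = 2 * ln c - ln (g j)"
      using assms(3,4) by (subst ln_div) (simp_all add: lnc less_imp_neq[symmetric])
    then show "G * (1 + ln (c\<^sup>2 / g j) - ln G) = G * (1 + 2 * ln c - ln G) - G * ln (g j)"
      by (simp only:) (simp add: algebra_simps)
  qed
  also have "\<dots> = real (card S) * (G * (1 + 2 * ln c - ln G)) - G * (\<Sum>j\<in>S. ln (g j))"
    by (simp add: sum_subtractf sum_distrib_left)
  finally have 1: "real (card S) * (G * (1 + 2 * ln c - ln G)) - G * (\<Sum>j\<in>S. ln (g j)) \<le> (\<Sum>j\<in>S. c\<^sup>2 / g j)" .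
  have "(real d - real (card S)) * (G * (1 + 2 * ln c - ln G)) \<le> (real d - real (card S)) * c\<^sup>2"
    using tangent[of "c\<^sup>2"] assms(2,3) lnc by (intro mult_left_mono) auto
  \<comment> \<open>Rounding the multiplicity up to d makes the term independent of S, so that it
    later sums to d times a squared norm.\<close>
  also have "\<dots> \<le> real d * c\<^sup>2" by (intro mult_right_mono) auto
  finally have 2: "(real d - real (card S)) * (G * (1 + 2 * ln c - ln G)) \<le> real d * c\<^sup>2" .
  have "ln (\<Prod>j\<in>S. g j) = (\<Sum>j\<in>S. ln (g j))"
    using assms(1) less_imp_neq[OF assms(4)] by (intro ln_prod) auto
  then have 3: "G * (1 + (\<Sum>j\<in>S. ln (g j)) - ln G) \<le> (\<Prod>j\<in>S. g j)"
    using tangent[of "\<Prod>j\<in>S. g j"] assms by (simp add: prod_pos)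
  \<comment> \<open>The terms ln (g j) cancel, and the remaining logarithms cancel by
    \<open>lnG\<close>.\<close>
  have "(real d + 1) * G = real (card S) * (G * (1 + 2 * ln c - ln G)) - G * (\<Sum>j\<in>S. ln (g j))
    + (real d - real (card S)) * (G * (1 + 2 * ln c - ln G)) + G * (1 + (\<Sum>j\<in>S. ln (g j)) - ln G)"
  proof -
    have "G * ((real d + 1) * ln G) = G * (2 * real d * ln c)" using lnG by simp
    then show ?thesis by (simp add: algebra_simps)
  qed
  with 1 2 3 show ?thesis by (simp add: G_def)
qed

text \<open>The AM-GM bound is summed with \<open>g j\<close> the norm of the letter (j, \<alpha>
  j). The first sum regroups into the total of the letter norms, and the third factorises over the
  coordinates.\<close>

lemma sum_powr_le_of_letter_norms:
  fixes c :: "(nat \<Rightarrow> nat) \<Rightarrow> real"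
  assumes J: "finite J" and q: "0 < q" and d: "1 \<le> d"
    and nonneg: "\<And>\<alpha>. 0 \<le> c \<alpha>"
    and supp: "\<And>\<alpha>. \<alpha> \<in> J \<rightarrow>\<^sub>E {..<q} \<Longrightarrow> c \<alpha> \<noteq> 0 \<Longrightarrow> card {i \<in> J. \<alpha> i \<noteq> 0} \<le> d"
    and letters: "(\<Sum>j\<in>J. \<Sum>t\<in>{1..<q}. sqrt (\<Sum>\<beta>\<in>J - {j} \<rightarrow>\<^sub>E {..<q}. (c (\<beta>(j := t)))\<^sup>2)) \<le> 1"
    and total: "(\<Sum>\<alpha>\<in>J \<rightarrow>\<^sub>E {..<q}. (c \<alpha>)\<^sup>2) \<le> 1"
  shows "(\<Sum>\<alpha>\<in>J \<rightarrow>\<^sub>E {..<q}. c \<alpha> powr (2 * real d / (real d + 1))) \<le> 3"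
proof -
  define X where "X = J \<rightarrow>\<^sub>E {..<q}"
  define f where "f j t = sqrt (\<Sum>\<beta>\<in>J - {j} \<rightarrow>\<^sub>E {..<q}. (c (\<beta>(j := t)))\<^sup>2)" for j t
  define S where "S \<alpha> = {i \<in> J. \<alpha> i \<noteq> 0}" for \<alpha> :: "nat \<Rightarrow> nat"
  have set: "{..<q} = insert 0 {1..<q}" using q by auto
  have f0: "0 \<le> f j t" for j t by (simp add: f_def sum_nonneg)
  have f2: "(f j t)\<^sup>2 = (\<Sum>\<beta>\<in>J - {j} \<rightarrow>\<^sub>E {..<q}. (c (\<beta>(j := t)))\<^sup>2)" for j t
    by (simp add: f_def sum_nonneg)
  have finS: "finite (S \<alpha>)" for \<alpha> using J by (simp add: S_def)
  have "(real d + 1) * c \<alpha> powr (2 * real d / (real d + 1))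
    \<le> (\<Sum>j\<in>S \<alpha>. (c \<alpha>)\<^sup>2 / f j (\<alpha> j)) + real d * (c \<alpha>)\<^sup>2 + (\<Prod>j\<in>S \<alpha>. f j (\<alpha> j))"
    if \<alpha>: "\<alpha> \<in> X" for \<alpha>
  proof (cases "c \<alpha> = 0")
    case True
    then show ?thesis using f0 by (simp add: prod_nonneg)
  next
    case False
    then have c: "0 < c \<alpha>" using nonneg[of \<alpha>] by simp
    \<comment> \<open>The square of \<open>c \<alpha>\<close> is one of the summands of the squared
      letter norm.\<close>
    have "0 < f j (\<alpha> j)" if j: "j \<in> S \<alpha>" for j
    proof -
      have "restrict \<alpha> (J - {j}) \<in> J - {j} \<rightarrow>\<^sub>E {..<q}" using \<alpha> by (auto simp: X_def)
      moreover have "(restrict \<alpha> (J - {j}))(j := \<alpha> j) = \<alpha>"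
        using \<alpha> j by (auto simp: X_def S_def fun_eq_iff PiE_iff extensional_def)
      ultimately have "(c \<alpha>)\<^sup>2 \<le> (f j (\<alpha> j))\<^sup>2"
        unfolding f2 using J member_le_sum[of "restrict \<alpha> (J - {j})" "J - {j} \<rightarrow>\<^sub>E {..<q}" "\<lambda>\<beta>. (c (\<beta>(j := \<alpha> j)))\<^sup>2"]
        by (simp add: finite_PiE)
      then have "c \<alpha> \<le> f j (\<alpha> j)" using f0 by (rule power2_le_imp_le)
      with c show ?thesis by simp
    qed
    then show ?thesis
      using supp \<alpha> False c finS by (intro powr_le_weighted_sum) (auto simp: X_def S_def)
  qed
  then have "(real d + 1) * (\<Sum>\<alpha>\<in>X. c \<alpha> powr (2 * real d / (real d + 1)))
    \<le> (\<Sum>\<alpha>\<in>X. (\<Sum>j\<in>S \<alpha>. (c \<alpha>)\<^sup>2 / f j (\<alpha> j)) + real d * (c \<alpha>)\<^sup>2 + (\<Prod>j\<in>S \<alpha>. f j (\<alpha> j)))"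
    unfolding sum_distrib_left by (intro sum_mono)
  also have "\<dots> = (\<Sum>\<alpha>\<in>X. \<Sum>j\<in>S \<alpha>. (c \<alpha>)\<^sup>2 / f j (\<alpha> j)) + real d * (\<Sum>\<alpha>\<in>X. (c \<alpha>)\<^sup>2)
      + (\<Sum>\<alpha>\<in>X. \<Prod>j\<in>S \<alpha>. f j (\<alpha> j))"
    by (simp add: sum.distrib sum_distrib_left)
  also have "(\<Sum>\<alpha>\<in>X. \<Sum>j\<in>S \<alpha>. (c \<alpha>)\<^sup>2 / f j (\<alpha> j)) \<le> 1"
  proof -
    have "(\<Sum>\<alpha>\<in>X. \<Sum>j\<in>S \<alpha>. (c \<alpha>)\<^sup>2 / f j (\<alpha> j))
      = (\<Sum>\<alpha>\<in>X. \<Sum>j\<in>J. if \<alpha> j \<noteq> 0 then (c \<alpha>)\<^sup>2 / f j (\<alpha> j) else 0)"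
      unfolding S_def using J by (intro sum.cong refl sum.inter_filter)
    also have "\<dots> = (\<Sum>j\<in>J. \<Sum>\<alpha>\<in>X. if \<alpha> j \<noteq> 0 then (c \<alpha>)\<^sup>2 / f j (\<alpha> j) else 0)"
      by (rule sum.swap)
    also have "\<dots> = (\<Sum>j\<in>J. \<Sum>t\<in>{1..<q}. f j t)"
    proof (rule sum.cong[OF refl])
      fix j assume j: "j \<in> J"
      have "(\<Sum>\<alpha>\<in>X. if \<alpha> j \<noteq> 0 then (c \<alpha>)\<^sup>2 / f j (\<alpha> j) else 0)
        = (\<Sum>t<q. \<Sum>\<beta>\<in>J - {j} \<rightarrow>\<^sub>E {..<q}. if t \<noteq> 0 then (c (\<beta>(j := t)))\<^sup>2 / f j t else 0)"
        using sum_PiE_insert[of j "J - {j}" "\<lambda>\<alpha>. if \<alpha> j \<noteq> 0 then (c \<alpha>)\<^sup>2 / f j (\<alpha> j) else 0" "{..<q}"] j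
        by (simp add: X_def insert_absorb cong: if_cong)
      also have "\<dots> = (\<Sum>t\<in>{1..<q}. \<Sum>\<beta>\<in>J - {j} \<rightarrow>\<^sub>E {..<q}. (c (\<beta>(j := t)))\<^sup>2 / f j t)"
        unfolding set by simp
      also have "\<dots> = (\<Sum>t\<in>{1..<q}. (f j t)\<^sup>2 / f j t)"
        by (simp only: f2 sum_divide_distrib)
      \<comment> \<open>Division by zero yields 0, so f^2 / f = f even for a vanishing letter
        norm.\<close>
      finally show "(\<Sum>\<alpha>\<in>X. if \<alpha> j \<noteq> 0 then (c \<alpha>)\<^sup>2 / f j (\<alpha> j) else 0) = (\<Sum>t\<in>{1..<q}. f j t)"
        by (simp add: power2_eq_square)
    qed
    finally show ?thesis using letters by (simp add: f_def)
  qed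
  also have "real d * (\<Sum>\<alpha>\<in>X. (c \<alpha>)\<^sup>2) \<le> real d"
    using total by (simp add: X_def mult_left_le)
  also have "(\<Sum>\<alpha>\<in>X. \<Prod>j\<in>S \<alpha>. f j (\<alpha> j)) \<le> 3"
  proof -
    \<comment> \<open>Giving the zero letter the factor 1 extends the products to all of
      \<open>J\<close>, so the sum over the grid becomes a product over coordinates.\<close>
    have "(\<Sum>\<alpha>\<in>X. \<Prod>j\<in>S \<alpha>. f j (\<alpha> j)) = (\<Sum>\<alpha>\<in>X. \<Prod>j\<in>J. if \<alpha> j \<noteq> 0 then f j (\<alpha> j) else 1)"
      unfolding S_def using J by (intro sum.cong refl prod.inter_filter)
    also have "\<dots> = (\<Prod>j\<in>J. \<Sum>t<q. if t \<noteq> 0 then f j t else 1)"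
      unfolding X_def by (rule prod_sum_PiE[symmetric, OF J]) simp
    also have "\<dots> = (\<Prod>j\<in>J. 1 + (\<Sum>t\<in>{1..<q}. f j t))"
      unfolding set by simp
    also have "\<dots> \<le> (\<Prod>j\<in>J. exp (\<Sum>t\<in>{1..<q}. f j t))"
      using f0 by (intro prod_mono) (auto intro!: exp_ge_add_one_self add_nonneg_nonneg sum_nonneg)
    also have "\<dots> = exp (\<Sum>j\<in>J. \<Sum>t\<in>{1..<q}. f j t)" using J by (simp add: exp_sum)
    also have "\<dots> \<le> exp 1" using letters by (simp add: f_def)
    also have "\<dots> \<le> 3" by (rule exp_le)
    finally show ?thesis .
  qed
  \<comment> \<open>The three bounds add up to 1 + d + 3 <= 3 (d + 1), as d >= 1.\<close>
  finally have "(real d + 1) * (\<Sum>\<alpha>\<in>X. c \<alpha> powr (2 * real d / (real d + 1))) \<le> (real d + 1) * 3"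
    using d by simp
  then show ?thesis unfolding X_def by (subst (asm) mult_le_cancel_left_pos) auto
qed

section \<open>From the torus norm to the coefficients: restriction to roots of unity and
  rescaling\<close>

theorem theorem2p12:
  shows "\<exists>c\<^sub>1 :: nat \<Rightarrow> real.
    (\<exists>A::real. \<forall>q\<ge>2. c\<^sub>1 q \<le> A * sqrt (real q)) \<and>
    (\<forall>q\<ge>2. \<forall>d\<ge>1. \<forall>N\<ge>1. \<forall>P \<in> poly_space d q N. \<forall>a :: (nat \<Rightarrow> nat) \<Rightarrow> complex.
       P = (\<lambda>z. \<Sum>\<alpha>\<in>multi_indices d q N. a \<alpha> * monomial N \<alpha> z) \<longrightarrow>
       (\<Sum>\<alpha>\<in>multi_indices d q N. cmod (a \<alpha>) powr (2 * real d / (real d + 1)))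
           powr ((real d + 1) / (2 * real d))
         \<le> c\<^sub>1 q ^ d * torus_norm N P)"
\<comment> \<open>480 = 4 * 5 * 24: the 4 comes from the fourth moment weight, the 5 from the
  coefficient bound, and 24 = 8 * 3 from the increments and the Blei-type inequality, absorbed
  through 24 <= 24^d.\<close>
proof (intro exI[of _ "\<lambda>q. 480 * sqrt (real q)"] conjI allI ballI impI)
  show "\<exists>A::real. \<forall>q\<ge>2. 480 * sqrt (real q) \<le> A * sqrt (real q)" by blast
next
  fix q d N :: nat and P and a :: "(nat \<Rightarrow> nat) \<Rightarrow> complex"
  assume q: "2 \<le> q" and d: "1 \<le> d"
    and P: "P = (\<lambda>z. \<Sum>\<alpha>\<in>multi_indices d q N. a \<alpha> * monomial N \<alpha> z)"
  define J where "J = {1..N}"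
  define I where "I = multi_indices d q N"
  define X where "X = J \<rightarrow>\<^sub>E {..<q}"
  \<comment> \<open>Extension by zero lets all sums run over the full grid.\<close>
  define b where "b \<alpha> = (if \<alpha> \<in> I then a \<alpha> else 0)" for \<alpha>
  define M where "M = torus_norm N P"
  define B where "B = 8 * (20 * sqrt (real q)) ^ d * M"
  define p where "p = 2 * real d / (real d + 1)"
  have J: "finite J" and q0: "0 < q" using q by (simp_all add: J_def)
  have finX: "finite X" unfolding X_def using J by (intro finite_PiE) auto
  have IX: "I \<subseteq> X" by (auto simp: I_def X_def J_def multi_indices_def)
  have supp: "card {i \<in> J. \<alpha> i \<noteq> 0} \<le> d" if "b \<alpha> \<noteq> 0" for \<alpha>
    using that by (auto simp: b_def I_def J_def multi_indices_def supp_def split: if_splits)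
  have bound: "cmod (cyc_poly q J b x) \<le> M" if "x \<in> X" for x
  proof -
    define z where "z = restrict (\<lambda>j. zeta q ^ x j) J"
    have "cyc_poly q J b x = (\<Sum>\<alpha>\<in>I. a \<alpha> * (\<Prod>i\<in>J. zeta q ^ (\<alpha> i * x i)))"
      unfolding cyc_poly_def X_def[symmetric]
      using IX finX by (intro sum.mono_neutral_cong_right) (auto simp: b_def)
    also have "\<dots> = P z"
      by (simp add: P I_def monomial_def z_def J_def power_mult[symmetric] mult.commute)
    finally have "cyc_poly q J b x = P z" .
    moreover have "z \<in> torus N" by (auto simp: z_def torus_def J_def)
    then have "cmod (P z) \<le> M"
      unfolding M_def torus_norm_def P by (intro cSUP_upper bdd_above_torus)
    ultimately show ?thesis by simp
  qed
  have "X \<noteq> {}" using q0 by (auto simp: X_def PiE_eq_empty_iff)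
  then obtain x0 where "x0 \<in> X" by blast
  then have M: "0 \<le> M" using order_trans[OF norm_ge_zero bound[of x0]] by simp
  have letters: "(\<Sum>j\<in>J. \<Sum>t\<in>{1..<q}. sqrt (\<Sum>\<beta>\<in>J - {j} \<rightarrow>\<^sub>E {..<q}. (cmod (b (\<beta>(j := t))))\<^sup>2)) \<le> B"
    unfolding B_def using supp bound
    by (intro sum_letter_norms_bound J q0 d) (auto simp: X_def)
  have total: "(\<Sum>\<alpha>\<in>X. (cmod (b \<alpha>))\<^sup>2) \<le> M\<^sup>2"
  proof -
    have "real q ^ card J * (\<Sum>\<alpha>\<in>X. (cmod (b \<alpha>))\<^sup>2) = (\<Sum>x\<in>X. (cmod (cyc_poly q J b x))\<^sup>2)"
      unfolding X_def by (rule parseval[OF J, symmetric])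
    also have "\<dots> \<le> (\<Sum>x\<in>X. M\<^sup>2)" by (intro sum_mono power_mono bound) auto
    also have "\<dots> = real q ^ card J * M\<^sup>2" using J by (simp add: X_def card_PiE)
    finally show ?thesis using q0 by simp
  qed
  have MB: "M \<le> B"
  proof -
    have "1 \<le> sqrt (real q)" using q by simp
    then have "1 \<le> (20 * sqrt (real q)) ^ d" by (intro one_le_power) linarith
    then have "1 * M \<le> 8 * (20 * sqrt (real q)) ^ d * M" using M by (intro mult_right_mono) auto
    then show ?thesis by (simp add: B_def)
  qed
  have sum_eq: "(\<Sum>\<alpha>\<in>I. cmod (a \<alpha>) powr p) = (\<Sum>\<alpha>\<in>X. cmod (b \<alpha>) powr p)"
    using IX finX by (intro sum.mono_neutral_cong_left) (auto simp: b_def)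
  have "(\<Sum>\<alpha>\<in>X. cmod (b \<alpha>) powr p) powr (1 / p) \<le> 3 * B"
  \<comment> \<open>Rescaling by \<open>B\<close> needs \<open>B\<close> positive; if the norm
    vanishes, Parseval already forces all coefficients to vanish.\<close>
  proof (cases "M = 0")
    case True
    then have "(\<Sum>\<alpha>\<in>X. (cmod (b \<alpha>))\<^sup>2) = 0"
      using total by (intro antisym sum_nonneg) auto
    then have "b \<alpha> = 0" if "\<alpha> \<in> X" for \<alpha>
      using that finX by (simp add: sum_nonneg_eq_0_iff)
    then show ?thesis using MB M by simp
  next
    case False
    then have B: "0 < B" using M MB by simp
    have p: "0 < p" using d by (simp add: p_def)
    have "(\<Sum>\<alpha>\<in>X. (cmod (b \<alpha>) / B) powr p) \<le> 3"
      unfolding p_def X_def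
    proof (rule sum_powr_le_of_letter_norms[OF J q0 d])
      show "(\<Sum>j\<in>J. \<Sum>t\<in>{1..<q}. sqrt (\<Sum>\<beta>\<in>J - {j} \<rightarrow>\<^sub>E {..<q}. (cmod (b (\<beta>(j := t))) / B)\<^sup>2)) \<le> 1"
        using letters B
        by (simp add: power_divide real_sqrt_divide flip: sum_divide_distrib)
      have "(\<Sum>\<alpha>\<in>X. (cmod (b \<alpha>))\<^sup>2) \<le> B\<^sup>2"
        using total power_mono[OF MB M, of 2] by simp
      then show "(\<Sum>\<alpha>\<in>J \<rightarrow>\<^sub>E {..<q}. (cmod (b \<alpha>) / B)\<^sup>2) \<le> 1"
        using B by (simp add: X_def power_divide flip: sum_divide_distrib)
    qed (use supp B in auto)
    then have "(\<Sum>\<alpha>\<in>X. cmod (b \<alpha>) powr p) \<le> 3 * B powr p"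
      using B by (simp add: powr_divide pos_divide_le_eq flip: sum_divide_distrib)
    then have "(\<Sum>\<alpha>\<in>X. cmod (b \<alpha>) powr p) powr (1 / p) \<le> (3 * B powr p) powr (1 / p)"
      using p by (intro powr_mono2 sum_nonneg) auto
    also have "\<dots> = 3 powr (1 / p) * B"
      using B p by (simp add: powr_mult powr_powr)
    \<comment> \<open>Here 1 / p <= 1, because d >= 1 gives p >= 1.\<close>
    also have "\<dots> \<le> 3 powr 1 * B"
      using B d by (intro mult_right_mono powr_mono) (auto simp: p_def)
    finally show ?thesis by simp
  qed
  also have "3 * B \<le> (480 * sqrt (real q)) ^ d * M"
  proof -
    have "(24::real) ^ 1 \<le> 24 ^ d" using d by (intro power_increasing) auto
    then have "24 * ((20 * sqrt (real q)) ^ d * M) \<le> 24 ^ d * ((20 * sqrt (real q)) ^ d * M)"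
      using M by (intro mult_right_mono) auto
    also have "24 ^ d * ((20 * sqrt (real q)) ^ d * M) = (24 * (20 * sqrt (real q))) ^ d * M"
      by (simp only: power_mult_distrib mult.assoc)
    finally show ?thesis by (simp add: B_def)
  qed
  finally show "(\<Sum>\<alpha>\<in>multi_indices d q N. cmod (a \<alpha>) powr (2 * real d / (real d + 1)))
      powr ((real d + 1) / (2 * real d)) \<le> (480 * sqrt (real q)) ^ d * torus_norm N P"
    unfolding sum_eq[symmetric] by (simp add: p_def I_def M_def)
qed

end
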